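(* For all $x\in\mathbb{N}_0$ and $y\ge0$ it holds that $f^*\big(x-f^*(x,y),\,y+f^*(x,y)\big)=0$.
   Context: Setting. $X=\mathbb{Z}$, $\beta\in(0,1)$ is a discount factor, $Z_1,Z_2,\ldots$ are i.i.d. integer-valued random variables with $\mathbb{P}(Z_n=k)=q_k$, $k\in\mathbb{Z}$; $Z$ denotes a generic copy. Standing assumptions: $\mathbb{E}Z^+<\infty$ (where $Z^+=\max\{Z,0\}$) and $\mathbb{P}(Z<0)>0$. Action sets: $A(x)=\{0,\ldots,x\}$ for $x\ge0$ and $A(x)=\{0\}$ for $x<0$; $D=\{(x,a):x\in X,a\in A(x)\}$. A policy $\pi=(\pi_k)_{k\ge0}$ is a sequence of maps assigning to each history $(x_0,a_0,\ldots,x_{k-1},a_{k-1},x_k)$ with $(x_m,a_m)\in D$ an action in $A(x_k)$; $\Pi$ is the set of all policies. Under $\pi$ and $x_0=x$, $a_k=\pi_k(x_0,a_0,\ldots,x_k)$, and $x_{k+1}=x_k-a_k+Z_{k+1}$ if $x_k\ge0$, $x_{k+1}=x_k$ if $x_k<0$; expectation is $\mathbb{E}_x^\pi$. The ruin time $\tau$ is the smallest $n\in\mathbb{N}_0$ with $x_n<0$ ($\tau=\infty$ if there is none). Fix $\gamma\in(0,1)$. For $x\in X$, $y\ge0$, $J(x,y)=\sup_{\pi\in\Pi}\mathbb{E}_x^\pi\big(\sum_{k=0}^{\tau-1}\beta^k a_k+y\big)^\gamma$, empty sums being $0$; thus $J(x,y)=y^\gamma$ for $x<0$. For $x\in\mathbb{N}_0$,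 $y\ge0$ let $G(x,y)=\sum_{k=-\infty}^\infty J(x+k,y)q_k$. For $x\ge0$, $f^*(x,y)$ is the largest maximiser over $a\in A(x)$ of $a\mapsto\beta^\gamma G(x-a,\frac{a+y}{\beta})$. *)

theory Defs
  imports "HOL-Probability.Probability"
begin

definition actions :: "int \<Rightarrow> int set" where
  "actions x = (if x \<ge> 0 then {0..x} else {0})"

definition constraint_set :: "(int \<times> int) set" where
  "constraint_set = {(x, a). a \<in> actions x}"

text \<open>In \<open>\<pi> k h x\<close>, the list \<open>h\<close> is \<open>[(x\<^sub>0, a\<^sub>0), \<dots>, (x\<^sub>k\<^sub>-\<^sub>1, a\<^sub>k\<^sub>-\<^sub>1)]\<close>
  and \<open>x\<close> is the current state \<open>x\<^sub>k\<close>. The values of \<open>\<pi> k h x\<close> for any other \<open>h\<close> are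
  irrelevant, since such \<open>h\<close> never arise below.\<close>
type_synonym policy = "nat \<Rightarrow> (int \<times> int) list \<Rightarrow> int \<Rightarrow> int"

definition policies :: "policy set" where
  "policies = {\<pi>. \<forall>k h x. length h = k \<and> set h \<subseteq> constraint_set \<longrightarrow> \<pi> k h x \<in> actions x}"

text \<open>For a noise path \<open>z\<close> (of which \<open>z 1, z 2, \<dots>\<close> are used), \<open>trajectory \<pi> x z k\<close> is the pair of
  \<open>[(x\<^sub>0, a\<^sub>0), \<dots>, (x\<^sub>k\<^sub>-\<^sub>1, a\<^sub>k\<^sub>-\<^sub>1)]\<close> and \<open>x\<^sub>k\<close>.\<close>
primrec trajectory :: "policy \<Rightarrow> int \<Rightarrow> (nat \<Rightarrow> int) \<Rightarrow> nat \<Rightarrow> (int \<times> int) list \<times> int" where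
  "trajectory \<pi> x z 0 = ([], x)"
| "trajectory \<pi> x z (Suc k) =
     (let (h, s) = trajectory \<pi> x z k; a = \<pi> k h s
      in (h @ [(s, a)], if s \<ge> 0 then s - a + z (Suc k) else s))"

definition state :: "policy \<Rightarrow> int \<Rightarrow> (nat \<Rightarrow> int) \<Rightarrow> nat \<Rightarrow> int" where
  "state \<pi> x z k = snd (trajectory \<pi> x z k)"

definition action :: "policy \<Rightarrow> int \<Rightarrow> (nat \<Rightarrow> int) \<Rightarrow> nat \<Rightarrow> int" where
  "action \<pi> x z k = \<pi> k (fst (trajectory \<pi> x z k)) (state \<pi> x z k)"

text \<open>The infimum of the empty set is \<open>\<infinity>\<close>.\<close>
definition ruin_time :: "policy \<Rightarrow> int \<Rightarrow> (nat \<Rightarrow> int) \<Rightarrow> enat" where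
  "ruin_time \<pi> x z = (INF n\<in>{n. state \<pi> x z n < 0}. enat n)"

text \<open>Rewards and values are taken in \<open>[0, \<infinity>]\<close>, so that the possibly infinite sum of dividends, its
  expectation and the supremum over all policies exist unconditionally.\<close>
definition discounted_dividends :: "real \<Rightarrow> policy \<Rightarrow> int \<Rightarrow> (nat \<Rightarrow> int) \<Rightarrow> ennreal" where
  "discounted_dividends \<beta> \<pi> x z =
     (\<Sum>k. if enat k < ruin_time \<pi> x z then ennreal (\<beta> ^ k * real_of_int (action \<pi> x z k)) else 0)"

definition ennreal_powr :: "ennreal \<Rightarrow> real \<Rightarrow> ennreal" where
  "ennreal_powr u \<gamma> = (if u = \<infinity> then \<infinity> else ennreal (enn2real u powr \<gamma>))"

definition J :: "'w measure \<Rightarrow> (nat \<Rightarrow> 'w \<Rightarrow> int) \<Rightarrow> real \<Rightarrow> real \<Rightarrow> int \<Rightarrow> real \<Rightarrow> ennreal" where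
  "J M Z \<beta> \<gamma> x y =
     (SUP \<pi>\<in>policies.
        \<integral>\<^sup>+\<omega>. ennreal_powr (discounted_dividends \<beta> \<pi> x (\<lambda>n. Z n \<omega>) + ennreal y) \<gamma> \<partial>M)"

definition G :: "'w measure \<Rightarrow> (nat \<Rightarrow> 'w \<Rightarrow> int) \<Rightarrow> (int \<Rightarrow> real) \<Rightarrow> real \<Rightarrow> real \<Rightarrow> int \<Rightarrow> real \<Rightarrow> ennreal" where
  "G M Z q \<beta> \<gamma> x y = (\<Sum>\<^sub>\<infinity>k. J M Z \<beta> \<gamma> (x + k) y * ennreal (q k))"

definition f_star :: "'w measure \<Rightarrow> (nat \<Rightarrow> 'w \<Rightarrow> int) \<Rightarrow> (int \<Rightarrow> real) \<Rightarrow> real \<Rightarrow> real \<Rightarrow> int \<Rightarrow> real \<Rightarrow> int" where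
  "f_star M Z q \<beta> \<gamma> x y =
     Max {a. is_arg_max
               (\<lambda>a. ennreal (\<beta> powr \<gamma>) * G M Z q \<beta> \<gamma> (x - a) ((real_of_int a + y) / \<beta>))
               (\<lambda>a. a \<in> actions x) a}"

end

theory Submission
  imports Defs
begin

text \<open>
  The objective of the one-step problem at \<open>(x, y)\<close> depends on an action \<open>a\<close> only through the
  state \<open>x - a\<close> that is left after paying \<open>a\<close> and the accumulated dividends \<open>y + a\<close>.
  Paying \<open>m\<close> first and then \<open>a\<close> in the same period is therefore worth as much as paying
  \<open>m + a\<close> at once: the objective at \<open>(x - m, y + m)\<close> is the one at \<open>(x, y)\<close>, shifted by \<open>m\<close>, and
  its admissible actions \<open>0, \<dots>, x - m\<close> correspond to \<open>m, \<dots>, x\<close>. If \<open>m\<close> is the largest maximiser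
  at \<open>(x, y)\<close>, then \<open>0\<close> maximises the shifted objective, and a positive maximiser \<open>a\<close> of it would
  make \<open>m + a\<close> a larger maximiser of the original one.
\<close>

lemma is_arg_max_Max:
  fixes \<phi> :: "'a::linorder \<Rightarrow> 'b::linorder"
  assumes "finite S" and "S \<noteq> {}"
  shows "is_arg_max \<phi> (\<lambda>a. a \<in> S) (Max {a. is_arg_max \<phi> (\<lambda>a. a \<in> S) a})"
proof -
  let ?B = "{a. is_arg_max \<phi> (\<lambda>a. a \<in> S) a}"
  have "finite ?B"
    by (rule finite_subset[OF _ assms(1)]) (auto simp: is_arg_max_def)
  moreover have "?B \<noteq> {}"
  proof -
    have "Max (\<phi> ` S) \<in> \<phi> ` S"
      using assms by (intro Max_in) auto
    then obtain s where "s \<in> S" and "\<phi> s = Max (\<phi> ` S)"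
      by auto
    then have "is_arg_max \<phi> (\<lambda>a. a \<in> S) s"
      using assms by (auto simp: is_arg_max_linorder)
    then show ?thesis by auto
  qed
  ultimately have "Max ?B \<in> ?B"
    by (rule Max_in)
  then show ?thesis by simp
qed

text \<open>
  Restricting to the actions from the largest maximiser \<open>m\<close> on keeps the maximum, which is then
  attained at \<open>m\<close> only; recentring at \<open>m\<close> moves this unique maximiser to \<open>0\<close>.
\<close>

lemma Max_arg_max_shifted_eq_0:
  fixes \<phi> :: "int \<Rightarrow> 'b::linorder" and x :: int
  assumes "x \<ge> 0"
  defines "m \<equiv> Max {a. is_arg_max \<phi> (\<lambda>a. a \<in> {0..x}) a}"
  shows "Max {a. is_arg_max (\<lambda>a. \<phi> (m + a)) (\<lambda>a. a \<in> {0..x - m}) a} = 0"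
proof -
  have m: "is_arg_max \<phi> (\<lambda>a. a \<in> {0..x}) m"
    unfolding m_def using assms(1) by (intro is_arg_max_Max) auto
  have largest: "b \<le> m" if "is_arg_max \<phi> (\<lambda>a. a \<in> {0..x}) b" for b
  proof -
    have "finite {a. is_arg_max \<phi> (\<lambda>a. a \<in> {0..x}) a}"
      by (rule finite_subset[of _ "{0..x}"]) (auto simp: is_arg_max_def)
    then show ?thesis
      unfolding m_def using that by (intro Max_ge) auto
  qed
  have "is_arg_max (\<lambda>a. \<phi> (m + a)) (\<lambda>a. a \<in> {0..x - m}) a \<longleftrightarrow> a = 0" for a
  proof
    assume a: "is_arg_max (\<lambda>a. \<phi> (m + a)) (\<lambda>a. a \<in> {0..x - m}) a"
    then have range: "0 \<le> a" "a \<le> x - m"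
      by (auto simp: is_arg_max_linorder)
    have "0 \<in> {0..x - m}"
      using range by auto
    with a have "\<phi> (m + 0) \<le> \<phi> (m + a)"
      unfolding is_arg_max_linorder by blast
    then have "is_arg_max \<phi> (\<lambda>a. a \<in> {0..x}) (m + a)"
      using m range by (auto simp: is_arg_max_linorder intro: order_trans)
    then have "m + a \<le> m"
      by (rule largest)
    with range show "a = 0" by simp
  next
    assume "a = 0"
    with m show "is_arg_max (\<lambda>a. \<phi> (m + a)) (\<lambda>a. a \<in> {0..x - m}) a"
      by (auto simp: is_arg_max_linorder)
  qed
  then show ?thesis by simp
qed

theorem lemma4p6:
  fixes M :: "'w measure" and Z :: "nat \<Rightarrow> 'w \<Rightarrow> int" and q :: "int \<Rightarrow> real"
    and \<beta> \<gamma> :: real and x :: int and y :: real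
  assumes "prob_space M"
    and "prob_space.indep_vars M (\<lambda>_. count_space UNIV) Z {1..}"
    and "\<And>n k. n \<ge> 1 \<Longrightarrow> measure M {\<omega> \<in> space M. Z n \<omega> = k} = q k"
    and "(\<integral>\<^sup>+\<omega>. ennreal (real_of_int (max (Z 1 \<omega>) 0)) \<partial>M) < \<infinity>"
    and "measure M {\<omega> \<in> space M. Z 1 \<omega> < 0} > 0"
    and "0 < \<beta>" and "\<beta> < 1"
    and "0 < \<gamma>" and "\<gamma> < 1"
    and "x \<ge> 0" and "y \<ge> 0"
  shows "f_star M Z q \<beta> \<gamma> (x - f_star M Z q \<beta> \<gamma> x y) (y + real_of_int (f_star M Z q \<beta> \<gamma> x y)) = 0"
proof -
  define \<phi> where
    "\<phi> a = ennreal (\<beta> powr \<gamma>) * G M Z q \<beta> \<gamma> (x - a) ((real_of_int a + y) / \<beta>)" for a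
  define m where "m = Max {a. is_arg_max \<phi> (\<lambda>a. a \<in> {0..x}) a}"
  have m_f_star: "f_star M Z q \<beta> \<gamma> x y = m"
    using \<open>x \<ge> 0\<close> by (simp add: f_star_def m_def \<phi>_def[abs_def] actions_def)
  have "m \<le> x"
    using is_arg_max_Max[of "{0..x}" \<phi>] \<open>x \<ge> 0\<close> by (simp add: m_def is_arg_max_def)
  then have acts: "actions (x - m) = {0..x - m}"
    by (simp add: actions_def)
  have shift: "(\<lambda>a. ennreal (\<beta> powr \<gamma>)
          * G M Z q \<beta> \<gamma> (x - m - a) ((real_of_int a + (y + real_of_int m)) / \<beta>))
      = (\<lambda>a. \<phi> (m + a))"
    by (simp add: \<phi>_def fun_eq_iff algebra_simps)
  show ?thesis
    unfolding m_f_star unfolding f_star_def acts shift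
    unfolding m_def by (rule Max_arg_max_shifted_eq_0[OF \<open>x \<ge> 0\<close>])
qed

end
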